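(* For every integer $n\geq 2$, the $n$-book graph satisfies $\chi_{D_L}(B_n)=\chi_D(B_n)$.
   Context: The $n$-book graph $B_n$ ($n\geq 2$) is the Cartesian product of the star $K_{1,n}$ and the path $P_2$ on two vertices; concretely it has vertices $v_0,w_0,v_1,w_1,\dots,v_n,w_n$ and edges $v_0w_0$, $v_0v_i$, $w_0w_i$, $v_iw_i$ for $1\leq i\leq n$. A vertex coloring is distinguishing if the only automorphism preserving all vertex colors is the identity. The distinguishing chromatic number $\chi_D(G)$ is the minimum $r$ such that $G$ has a proper distinguishing coloring with $r$ colors. Given a list assignment $L$ (a finite set $L(v)$ of colors for each vertex), $G$ is properly $L$-distinguishable if there is a proper distinguishing coloring $f$ with $f(v)\in L(v)$ for all $v$; $\chi_{D_L}(G)$ is the minimum $k$ such that $G$ is properly $L$-distinguishable for every list assignment with $|L(v)|=k$ for all $v$. *)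

theory Defs
  imports Main
begin

text \<open>A simple graph is a pair of a vertex set and a set of edges, each edge being a set of two
  distinct vertices.\<close>

type_synonym 'a ugraph = "'a set \<times> 'a set set"

abbreviation verts :: "'a ugraph \<Rightarrow> 'a set" where "verts G \<equiv> fst G"
abbreviation edges :: "'a ugraph \<Rightarrow> 'a set set" where "edges G \<equiv> snd G"

definition simple_graph :: "'a ugraph \<Rightarrow> bool" where
  "simple_graph G \<longleftrightarrow> finite (verts G) \<and> (\<forall>e\<in>edges G. e \<subseteq> verts G \<and> card e = 2)"

definition star_graph :: "nat \<Rightarrow> nat ugraph" where
  "star_graph n = ({0..n}, {{0, i} |i. 1 \<le> i \<and> i \<le> n})"

definition path_graph :: "nat \<Rightarrow> nat ugraph" where
  "path_graph m = ({..<m}, {{i, Suc i} |i. Suc i < m})"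

definition cartesian_product :: "'a ugraph \<Rightarrow> 'b ugraph \<Rightarrow> ('a \<times> 'b) ugraph" where
  "cartesian_product G H =
     (verts G \<times> verts H,
      {{(u, x), (u', x)} |u u' x. {u, u'} \<in> edges G \<and> x \<in> verts H} \<union>
      {{(u, x), (u, x')} |u x x'. u \<in> verts G \<and> {x, x'} \<in> edges H})"

text \<open>The vertices $v_i$ and $w_i$ are \<^term>\<open>(i, 0)\<close> and \<^term>\<open>(i, 1)\<close>.\<close>

definition book_graph :: "nat \<Rightarrow> (nat \<times> nat) ugraph" where
  "book_graph n = cartesian_product (star_graph n) (path_graph 2)"

definition automorphism :: "'a ugraph \<Rightarrow> ('a \<Rightarrow> 'a) \<Rightarrow> bool" where
  "automorphism G \<phi> \<longleftrightarrow> bij_betw \<phi> (verts G) (verts G) \<and>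
     (\<forall>u\<in>verts G. \<forall>v\<in>verts G. {\<phi> u, \<phi> v} \<in> edges G \<longleftrightarrow> {u, v} \<in> edges G)"

definition proper_coloring :: "'a ugraph \<Rightarrow> ('a \<Rightarrow> 'c) \<Rightarrow> bool" where
  "proper_coloring G f \<longleftrightarrow> (\<forall>u v. {u, v} \<in> edges G \<longrightarrow> f u \<noteq> f v)"

definition distinguishing :: "'a ugraph \<Rightarrow> ('a \<Rightarrow> 'c) \<Rightarrow> bool" where
  "distinguishing G f \<longleftrightarrow>
     (\<forall>\<phi>. automorphism G \<phi> \<and> (\<forall>v\<in>verts G. f (\<phi> v) = f v) \<longrightarrow> (\<forall>v\<in>verts G. \<phi> v = v))"

definition properly_distinguishable :: "'a ugraph \<Rightarrow> nat \<Rightarrow> bool" where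
  "properly_distinguishable G r \<longleftrightarrow>
     (\<exists>f :: 'a \<Rightarrow> nat. f ` verts G \<subseteq> {..<r} \<and> proper_coloring G f \<and> distinguishing G f)"

definition distinguishing_chromatic_number :: "'a ugraph \<Rightarrow> nat" where
  "distinguishing_chromatic_number G = (LEAST r. properly_distinguishable G r)"

definition properly_L_distinguishable :: "'a ugraph \<Rightarrow> ('a \<Rightarrow> 'c set) \<Rightarrow> bool" where
  "properly_L_distinguishable G L \<longleftrightarrow>
     (\<exists>f. (\<forall>v\<in>verts G. f v \<in> L v) \<and> proper_coloring G f \<and> distinguishing G f)"

text \<open>Colors are natural numbers.  Finiteness of the lists has to be required explicitly, since
  infinite sets have \<^const>\<open>card\<close> 0.\<close>

definition properly_list_distinguishable :: "'a ugraph \<Rightarrow> nat \<Rightarrow> bool" where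
  "properly_list_distinguishable G k \<longleftrightarrow>
     (\<forall>L :: 'a \<Rightarrow> nat set. (\<forall>v\<in>verts G. finite (L v) \<and> card (L v) = k)
        \<longrightarrow> properly_L_distinguishable G L)"

definition list_distinguishing_chromatic_number :: "'a ugraph \<Rightarrow> nat" where
  "list_distinguishing_chromatic_number G = (LEAST k. properly_list_distinguishable G k)"

lemma verts_book_graph: "verts (book_graph n) = {0..n} \<times> {0, 1}"
  by (auto simp: book_graph_def cartesian_product_def star_graph_def path_graph_def)

lemma edges_book_graph:
  "edges (book_graph n) =
     {{(0, 0), (0, 1)}} \<union> (\<Union>i\<in>{1..n}. {{(0, 0), (i, 0)}, {(0, 1), (i, 1)}, {(i, 0), (i, 1)}})"
proof (rule set_eqI)
  fix e :: "(nat \<times> nat) set"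
  have p: "{x, x'} \<in> edges (path_graph 2) \<longleftrightarrow> x = 0 \<and> x' = 1 \<or> x = 1 \<and> x' = 0" for x x'
    by (auto simp: path_graph_def doubleton_eq_iff)
  have s: "{u, u'} \<in> edges (star_graph n) \<longleftrightarrow>
      u = 0 \<and> u' \<in> {1..n} \<or> u \<in> {1..n} \<and> u' = 0" for u u'
    by (auto simp: star_graph_def doubleton_eq_iff)
  have v: "x \<in> verts (path_graph 2) \<longleftrightarrow> x = 0 \<or> x = 1" for x
    by (auto simp: path_graph_def)
  have w: "u \<in> verts (star_graph n) \<longleftrightarrow> u = 0 \<or> u \<in> {1..n}" for u
    by (auto simp: star_graph_def)
  have aux1: "(\<exists>u u' x. e = {(u, x), (u', x)} \<and> (u = 0 \<and> u' \<in> {1..n} \<or> u \<in> {1..n} \<and> u' = 0) \<and> (x = 0 \<or> x = 1))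
      \<longleftrightarrow> (\<exists>i\<in>{1..n}. e = {(0, 0), (i, 0)} \<or> e = {(0, 1), (i, 1)})" (is "?l \<longleftrightarrow> ?r")
  proof
    assume ?l
    then obtain u u' x where e: "e = {(u, x), (u', x)}" and "x = 0 \<or> x = 1"
      and "u = 0 \<and> u' \<in> {1..n} \<or> u \<in> {1..n} \<and> u' = 0" by blast
    moreover have "e = {(u', x), (u, x)}" using e by (simp only: insert_commute)
    ultimately show ?r by metis
  next
    assume ?r
    then show ?l by metis
  qed
  have aux2: "(\<exists>u x x'. e = {(u, x), (u, x')} \<and> (u = 0 \<or> u \<in> {1..n}) \<and> (x = 0 \<and> x' = 1 \<or> x = 1 \<and> x' = 0))
      \<longleftrightarrow> e = {(0, 0), (0, 1)} \<or> (\<exists>i\<in>{1..n}. e = {(i, 0), (i, 1)})" (is "?l \<longleftrightarrow> ?r")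
  proof
    assume ?l
    then obtain u x x' where e: "e = {(u, x), (u, x')}" and "u = 0 \<or> u \<in> {1..n}"
      and "x = 0 \<and> x' = 1 \<or> x = 1 \<and> x' = 0" by blast
    moreover have "e = {(u, x'), (u, x)}" using e by (simp only: insert_commute)
    ultimately show ?r by metis
  next
    assume ?r
    then show ?l by metis
  qed
  have "e \<in> edges (book_graph n) \<longleftrightarrow>
      (\<exists>u u' x. e = {(u, x), (u', x)} \<and> {u, u'} \<in> edges (star_graph n) \<and> x \<in> verts (path_graph 2)) \<or>
      (\<exists>u x x'. e = {(u, x), (u, x')} \<and> u \<in> verts (star_graph n) \<and> {x, x'} \<in> edges (path_graph 2))"
    by (simp add: book_graph_def cartesian_product_def)
  also have "(\<exists>u u' x. e = {(u, x), (u', x)} \<and> {u, u'} \<in> edges (star_graph n) \<and> x \<in> verts (path_graph 2))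
      \<longleftrightarrow> (\<exists>i\<in>{1..n}. e = {(0, 0), (i, 0)} \<or> e = {(0, 1), (i, 1)})"
    unfolding s v by (rule aux1)
  also have "(\<exists>u x x'. e = {(u, x), (u, x')} \<and> u \<in> verts (star_graph n) \<and> {x, x'} \<in> edges (path_graph 2))
      \<longleftrightarrow> e = {(0, 0), (0, 1)} \<or> (\<exists>i\<in>{1..n}. e = {(i, 0), (i, 1)})"
    unfolding p w by (rule aux2)
  finally show "e \<in> edges (book_graph n) \<longleftrightarrow> e \<in> {{(0, 0), (0, 1)}} \<union>
      (\<Union>i\<in>{1..n}. {{(0, 0), (i, 0)}, {(0, 1), (i, 1)}, {(i, 0), (i, 1)}})"
    by blast
qed

lemma simple_graph_book_graph: "simple_graph (book_graph n)"
  unfolding simple_graph_def verts_book_graph edges_book_graph by auto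

text \<open>For a simple graph both minima are taken over nonempty sets, as an injective coloring is
  proper and distinguishing.\<close>

lemma inj_coloring:
  assumes "simple_graph G" "inj_on f (verts G)"
  shows "proper_coloring G f" "distinguishing G f"
proof -
  have "f u \<noteq> f v" if "{u, v} \<in> edges G" for u v
  proof -
    have "{u, v} \<subseteq> verts G" "card {u, v} = 2"
      using assms(1) that unfolding simple_graph_def by blast+
    then have "u \<noteq> v" "u \<in> verts G" "v \<in> verts G" by auto
    then show ?thesis using assms(2) by (auto dest: inj_onD)
  qed
  then show "proper_coloring G f" by (simp add: proper_coloring_def)
  show "distinguishing G f"
    using assms(2) unfolding distinguishing_def automorphism_def
    by (meson bij_betwE inj_onD)
qed

lemma properly_distinguishable_card:
  assumes "simple_graph G" shows "properly_distinguishable G (card (verts G))"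
proof -
  have "finite (verts G)" using assms by (simp add: simple_graph_def)
  then obtain f where "bij_betw f (verts G) {0..<card (verts G)}"
    using ex_bij_betw_finite_nat by blast
  then show ?thesis
    using inj_coloring[OF assms, of f] unfolding properly_distinguishable_def
    by (metis atLeast0LessThan bij_betw_def order_refl)
qed

lemma properly_list_distinguishable_card:
  assumes "simple_graph G" shows "properly_list_distinguishable G (card (verts G))"
  unfolding properly_list_distinguishable_def
proof (intro allI impI)
  fix L :: "'a \<Rightarrow> nat set"
  assume L: "\<forall>v\<in>verts G. finite (L v) \<and> card (L v) = card (verts G)"
  have fin: "finite (verts G)" using assms by (simp add: simple_graph_def)
  have "\<exists>f. inj_on f S \<and> (\<forall>v\<in>S. f v \<in> L v)" if "S \<subseteq> verts G" for S
    using finite_subset[OF that fin] that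
  proof (induction S rule: finite_induct)
    case empty
    then show ?case by simp
  next
    case (insert x S)
    then obtain f where f: "inj_on f S" "\<forall>v\<in>S. f v \<in> L v" by auto
    have "card (f ` S) \<le> card S" by (rule card_image_le) fact
    also have "\<dots> < card (insert x S)" using insert.hyps by simp
    also have "\<dots> \<le> card (L x)" using insert.prems L fin by (simp add: card_mono)
    finally have "\<not> L x \<subseteq> f ` S" using insert.hyps by (meson card_mono finite_imageI not_less)
    then obtain c where "c \<in> L x" "c \<notin> f ` S" by blast
    then have "inj_on (f(x := c)) (insert x S)" "\<forall>v\<in>insert x S. (f(x := c)) v \<in> L v"
      using f insert.hyps by (auto simp: inj_on_def)
    then show ?case by blast
  qed
  then obtain f where "inj_on f (verts G)" "\<forall>v\<in>verts G. f v \<in> L v" by blast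
  then show "properly_L_distinguishable G L"
    using inj_coloring[OF assms] unfolding properly_L_distinguishable_def by blast
qed

end

theory Submission
  imports Defs "HOL-Combinatorics.Transposition"
begin

text \<open>For \<open>n \<ge> 2\<close>, a proper coloring of the book graph is distinguishing iff the \<open>n\<close> pages
  \<open>(v\<^sub>i, w\<^sub>i)\<close> receive pairwise distinct ordered color pairs: the spine ends are the only vertices of
  degree at least 3 and have different colors.  With \<open>r\<close> colors and spine colors \<open>a \<noteq> b\<close> there are
  \<open>(r - 1)(r - 2) + 1\<close> admissible pairs \<open>(x, y)\<close> with \<open>x \<noteq> a\<close>, \<open>y \<noteq> b\<close>, \<open>x \<noteq> y\<close>, so this number
  must be at least \<open>n\<close>.  With lists of size \<open>k\<close> a page has at least \<open>(k - 1)(k - 2)\<close> admissible pairs,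
  and at least one more unless removing \<open>a\<close> and \<open>b\<close> from its two lists leaves the same set of size
  \<open>k - 1\<close>.  At most one pair \<open>a \<noteq> b\<close> is exceptional in this sense for a given page, so the spine can be
  colored such that page 1 is not exceptional; choosing the pairs of the pages greedily, with page 1
  last, then succeeds under the same condition on \<open>n\<close>.\<close>

section \<open>Adjacency and proper colorings of the book graph\<close>

lemma book_graph_adj:
  "{(i, x), (j, y)} \<in> edges (book_graph n) \<longleftrightarrow>
     i \<le> n \<and> j \<le> n \<and> x \<in> {0, 1} \<and> y \<in> {0, 1} \<and>
     (x = y \<and> (i = 0 \<longleftrightarrow> j \<noteq> 0) \<or> i = j \<and> x \<noteq> y)"
  unfolding edges_book_graph by (auto simp: doubleton_eq_iff)

lemma proper_coloring_book_graph_iff: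
  "proper_coloring (book_graph n) f \<longleftrightarrow>
     f (0, 0) \<noteq> f (0, 1) \<and>
     (\<forall>i\<in>{1..n}. f (i, 0) \<noteq> f (0, 0) \<and> f (i, 1) \<noteq> f (0, 1) \<and> f (i, 0) \<noteq> f (i, 1))"
  (is "?l \<longleftrightarrow> ?r")
proof
  assume ?l
  then have *: "{(i, x), (j, y)} \<in> edges (book_graph n) \<Longrightarrow> f (i, x) \<noteq> f (j, y)" for i j x y
    by (simp add: proper_coloring_def)
  show ?r
    by (intro conjI ballI *) (auto simp: book_graph_adj)
next
  assume r: ?r
  have spine: "f (0, 0) \<noteq> f (0, 1)" using r by blast
  have page: "f (i, 0) \<noteq> f (0, 0) \<and> f (i, 1) \<noteq> f (0, 1) \<and> f (i, 0) \<noteq> f (i, 1)"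
    if "i \<le> n" "i \<noteq> 0" for i
    using r that by (simp add: Suc_le_eq)
  have "f (i, x) \<noteq> f (j, y)" if "{(i, x), (j, y)} \<in> edges (book_graph n)" for i j x y
    using that spine page[of i] page[of j] unfolding book_graph_adj
    by (cases "i = 0"; cases "j = 0") auto
  then show ?l by (auto simp: proper_coloring_def)
qed

section \<open>Automorphisms and distinguishing colorings\<close>

lemma automorphism_book_graph_permute_pages:
  assumes "bij_betw p {0..n} {0..n}" "p 0 = 0"
  shows "automorphism (book_graph n) (map_prod p id)"
proof -
  have p: "p i \<le> n" if "i \<le> n" for i
    using bij_betwE[OF assms(1)] that by auto
  have inj: "p i = p j \<longleftrightarrow> i = j" if "i \<le> n" "j \<le> n" for i j
    using assms(1) that by (auto simp: bij_betw_def inj_on_def)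
  have zero: "p i = 0 \<longleftrightarrow> i = 0" if "i \<le> n" for i
    using inj[of i 0] that assms(2) by simp
  have "bij_betw (map_prod p id) ({0..n} \<times> {0, 1 :: nat}) ({0..n} \<times> {0, 1})"
    using assms(1) by (intro bij_betw_map_prod) auto
  then show ?thesis
    unfolding automorphism_def verts_book_graph
    by (auto simp: book_graph_adj p inj zero)
qed

text \<open>Swapping two pages with the same color pair would be an automorphism that preserves all
  colors.\<close>

lemma distinguishing_book_graph_pages_inj:
  assumes "distinguishing (book_graph n) f"
  shows "inj_on (\<lambda>i. (f (i, 0), f (i, 1))) {1..n}"
proof (rule inj_onI)
  fix j k assume jk: "j \<in> {1..n}" "k \<in> {1..n}" "(f (j, 0), f (j, 1)) = (f (k, 0), f (k, 1))"
  let ?p = "transpose j k"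
  have "bij_betw ?p {0..n} {0..n}"
    using jk by (auto simp: bij_betw_def)
  then have "automorphism (book_graph n) (map_prod ?p id)"
    using jk by (intro automorphism_book_graph_permute_pages) (auto simp: transpose_def)
  moreover have "\<forall>v\<in>verts (book_graph n). f (map_prod ?p id v) = f v"
    using jk by (auto simp: verts_book_graph transpose_def)
  ultimately have "\<forall>v\<in>verts (book_graph n). map_prod ?p id v = v"
    using assms unfolding distinguishing_def by blast
  then have "map_prod ?p id (j, 0) = (j, 0)"
    using jk unfolding verts_book_graph by force
  then show "j = k" by simp
qed

text \<open>A degree argument: a spine end has at least three neighbors as \<open>n \<ge> 2\<close>,
  a page vertex only two.\<close>

lemma automorphism_book_graph_spine:
  assumes "n \<ge> 2" "automorphism (book_graph n) \<phi>" "x \<in> {0, 1}"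
  shows "\<phi> (0, x) \<in> {(0, 0), (0, 1)}"
proof (rule ccontr)
  assume nspine: "\<phi> (0, x) \<notin> {(0, 0), (0, 1)}"
  let ?V = "verts (book_graph n)"
  have inj: "inj_on \<phi> ?V" and img: "\<phi> ` ?V = ?V"
    using assms(2) by (auto simp: automorphism_def bij_betw_def)
  obtain i y where iy: "\<phi> (0, x) = (i, y)" by fastforce
  \<comment> \<open>Three neighbors of \<open>(0, x)\<close>: the other spine end and one vertex on
    each of the pages 1 and 2.\<close>
  define T where "T = {(0, 1 - x), (1, x), (2 :: nat, x)}"
  have T: "T \<subseteq> ?V" "card T = 3"
    using assms unfolding T_def verts_book_graph by auto
  have "(0, x) \<in> ?V" using assms by (auto simp: verts_book_graph)
  then have "(i, y) \<in> ?V" using img iy by (metis imageI)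
  then have "i \<noteq> 0" "y \<in> {0, 1}" using nspine iy by (auto simp: verts_book_graph)
  have "\<phi> t \<in> {(0, y), (i, 1 - y)}" if "t \<in> T" for t
  proof -
    have "{(0, x), t} \<in> edges (book_graph n)"
      using that assms unfolding T_def by (auto simp: book_graph_adj)
    moreover have "{\<phi> (0, x), \<phi> t} \<in> edges (book_graph n) \<longleftrightarrow> {(0, x), t} \<in> edges (book_graph n)"
      using assms(2) subsetD[OF T(1) that] \<open>(0, x) \<in> ?V\<close> by (simp add: automorphism_def)
    ultimately have "{(i, y), \<phi> t} \<in> edges (book_graph n)"
      using iy by simp
    then show ?thesis
      using \<open>i \<noteq> 0\<close> by (cases "\<phi> t") (auto simp: book_graph_adj)
  qed
  then have "\<phi> ` T \<subseteq> {(0, y), (i, 1 - y)}"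
    by (rule image_subsetI)
  then have "card (\<phi> ` T) \<le> card {(0, y), (i, 1 - y)}"
    by (intro card_mono) simp
  also have "\<dots> \<le> 2" by (simp add: card_insert_if)
  finally show False
    using card_image[OF inj_on_subset[OF inj T(1)]] T(2) by simp
qed

text \<open>The spine ends differ in color, so a color-preserving automorphism fixes both. It then
  permutes whole pages without flipping them, and distinct color pairs leave only the
  identity.\<close>

lemma distinguishing_book_graphI:
  assumes "n \<ge> 2" "proper_coloring (book_graph n) f"
    and pages: "inj_on (\<lambda>i. (f (i, 0), f (i, 1))) {1..n}"
  shows "distinguishing (book_graph n) f"
  unfolding distinguishing_def
proof (intro allI impI ballI; elim conjE)
  fix \<phi> v
  assume auto: "automorphism (book_graph n) \<phi>"
    and pres: "\<forall>v\<in>verts (book_graph n). f (\<phi> v) = f v" and v: "v \<in> verts (book_graph n)"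
  let ?V = "verts (book_graph n)"
  have inj: "inj_on \<phi> ?V"
    using auto by (auto simp: automorphism_def bij_betw_def)
  have adj: "{\<phi> u, \<phi> w} \<in> edges (book_graph n) \<longleftrightarrow> {u, w} \<in> edges (book_graph n)"
    if "u \<in> ?V" "w \<in> ?V" for u w
    using auto that by (simp add: automorphism_def)
  have spine: "\<phi> (0, x) = (0, x)" if "x \<in> {0, 1}" for x
  proof -
    have "f (\<phi> (0, x)) = f (0, x)" using pres that by (auto simp: verts_book_graph)
    moreover have "f (0, 0) \<noteq> f (0, 1)"
      using assms(2) by (simp add: proper_coloring_book_graph_iff)
    ultimately show ?thesis
      using automorphism_book_graph_spine[OF assms(1) auto that] that by auto
  qed
  have page: "\<exists>j\<in>{1..n}. \<phi> (i, x) = (j, x)" if "i \<in> {1..n}" "x \<in> {0, 1}" for i x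
  proof -
    obtain j y where jy: "\<phi> (i, x) = (j, y)" by fastforce
    have V: "(0, x) \<in> ?V" "(i, x) \<in> ?V" "(0, 1 - x) \<in> ?V"
      using that by (auto simp: verts_book_graph)
    have "{(0, x), (j, y)} \<in> edges (book_graph n)"
      using adj[OF V(1,2)] spine[OF that(2)] jy that by (simp add: book_graph_adj)
    \<comment> \<open>The image of \<open>(i, x)\<close> is a neighbor of \<open>(0, x)\<close>; the
      other spine end is excluded because it is already its own image.\<close>
    moreover have "(j, y) \<noteq> (0, 1 - x)"
      using inj_onD[OF inj, of "(i, x)" "(0, 1 - x)"] V spine[of "1 - x"] jy that by auto
    ultimately show ?thesis
      using jy that by (auto simp: book_graph_adj)
  qed
  obtain i x where ix: "v = (i, x)" "i \<le> n" "x \<in> {0, 1}"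
    using v by (auto simp: verts_book_graph)
  show "\<phi> v = v"
  proof (cases "i = 0")
    case True
    then show ?thesis using spine ix by simp
  next
    case False
    then have i: "i \<in> {1..n}" using ix by simp
    obtain j where j: "j \<in> {1..n}" "\<phi> (i, 0) = (j, 0)" using page[OF i, of 0] by auto
    obtain k where k: "k \<in> {1..n}" "\<phi> (i, 1) = (k, 1)" using page[OF i, of 1] by auto
    have V: "(i, 0) \<in> ?V" "(i, 1) \<in> ?V" using ix by (auto simp: verts_book_graph)
    \<comment> \<open>The page edge is mapped to an edge between the two layers, and both of its
      ends must lie on one page.\<close>
    have "j = k"
      using adj[OF V] j k i by (auto simp: book_graph_adj)
    have "f (\<phi> (i, 0)) = f (i, 0)" "f (\<phi> (i, 1)) = f (i, 1)"
      using pres V by blast+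
    then have "j = i"
      using inj_onD[OF pages, of j i] i j k \<open>j = k\<close> by simp
    then show ?thesis using ix j k \<open>j = k\<close> by auto
  qed
qed

section \<open>Counting the admissible color pairs of a page\<close>

definition page_pairs :: "'c \<Rightarrow> 'c \<Rightarrow> 'c set \<Rightarrow> 'c set \<Rightarrow> ('c \<times> 'c) set" where
  "page_pairs a b X Y = {(x, y) \<in> X \<times> Y. x \<noteq> a \<and> y \<noteq> b \<and> x \<noteq> y}"

text \<open>Deleting the spine colors leaves a product of two sets, and the condition
  \<open>x \<noteq> y\<close> removes its diagonal, a copy of their intersection.\<close>

lemma card_page_pairs:
  assumes "finite X" "finite Y"
  shows "card (page_pairs a b X Y)
       = card (X - {a}) * card (Y - {b}) - card ((X - {a}) \<inter> (Y - {b}))"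
proof -
  let ?D = "(\<lambda>x. (x, x)) ` ((X - {a}) \<inter> (Y - {b}))"
  have "page_pairs a b X Y = (X - {a}) \<times> (Y - {b}) - ?D"
    by (auto simp: page_pairs_def)
  moreover have "card ?D = card ((X - {a}) \<inter> (Y - {b}))"
    by (rule card_image) (auto simp: inj_on_def)
  moreover have "?D \<subseteq> (X - {a}) \<times> (Y - {b})" by auto
  ultimately show ?thesis
    using assms by (simp add: card_Diff_subset card_cartesian_product)
qed

text \<open>Identical lists model ordinary colorings. With \<open>k = card X\<close>, the reduced
  lists have \<open>k - 1\<close> elements and share \<open>k - 2\<close>, and
  \<open>(k - 1) * (k - 1) - (k - 2)\<close> is the claimed value.\<close>

lemma card_page_pairs_same:
  assumes "finite X" "a \<in> X" "b \<in> X" "a \<noteq> b"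
  shows "card (page_pairs a b X X) = (card X - 1) * (card X - 2) + 1"
proof -
  have "card X \<ge> card {a, b}" using assms by (intro card_mono) auto
  \<comment> \<open>Writing the size as \<open>m + 2\<close> removes the truncated
    subtractions.\<close>
  then obtain m where m: "card X = Suc (Suc m)"
    using assms(4) by (metis card_2_iff le_Suc_ex add_2_eq_Suc)
  have "(X - {a}) \<inter> (X - {b}) = X - {a, b}" by auto
  then have "card ((X - {a}) \<inter> (X - {b})) = m"
    using assms m by (simp add: card_Diff_subset)
  then show ?thesis
    using assms m by (simp add: card_page_pairs)
qed

text \<open>The reduced lists have \<open>k - 1\<close> or \<open>k\<close> elements, and their
  overlap is at most the smaller size. The first bound is attained only when both have size
  \<open>k - 1\<close> and coincide.\<close>

lemma card_page_pairs_ge: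
  assumes "finite X" "finite Y" "card X = k" "card Y = k" "k \<ge> 2"
  shows "card (page_pairs a b X Y) \<ge> (k - 1) * (k - 2)"
    and "\<not> (a \<in> X \<and> X - {a} = Y - {b}) \<Longrightarrow> card (page_pairs a b X Y) \<ge> (k - 1) * (k - 2) + 1"
proof -
  obtain m where m: "k = Suc (Suc m)" using assms(5) by (metis le_Suc_ex add_2_eq_Suc)
  define p q d where "p = card (X - {a})" "q = card (Y - {b})" "d = card ((X - {a}) \<inter> (Y - {b}))"
  note defs = this
  have p: "p = Suc m \<or> p = Suc (Suc m)" and q: "q = Suc m \<or> q = Suc (Suc m)"
    using assms m by (auto simp: defs card_Diff_singleton_if)
  have d: "d \<le> p" "d \<le> q"
    using assms by (auto simp: defs intro: card_mono)
  have card: "card (page_pairs a b X Y) = p * q - d"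
    using assms by (simp add: card_page_pairs defs)
  show "card (page_pairs a b X Y) \<ge> (k - 1) * (k - 2)"
    using p q d unfolding card m by auto
  assume ne: "\<not> (a \<in> X \<and> X - {a} = Y - {b})"
  \<comment> \<open>With full overlap both reduced lists equal their intersection, and size
    \<open>k - 1\<close> means that \<open>a\<close> was in \<open>X\<close>: the excluded
    case.\<close>
  have "d < Suc m" if "p = Suc m" "q = Suc m"
  proof (rule ccontr)
    assume "\<not> d < Suc m"
    then have "d = p" "d = q" using d that by auto
    then have "(X - {a}) \<inter> (Y - {b}) = X - {a}" "(X - {a}) \<inter> (Y - {b}) = Y - {b}"
      using assms by (intro card_subset_eq; simp add: defs)+
    moreover have "a \<in> X"
      using that(1) assms m by (auto simp: defs card_Diff_singleton_if split: if_splits)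
    ultimately show False using ne by auto
  qed
  then show "card (page_pairs a b X Y) \<ge> (k - 1) * (k - 2) + 1"
    using p q d unfolding card m by auto
qed

section \<open>Greedy choice of distinct representatives\<close>

lemma extend_distinct_representatives:
  assumes "finite J" "x \<notin> J" "inj_on g J" "\<forall>i\<in>J. g i \<in> S i" "card J < card (S x)"
  shows "\<exists>h. inj_on h (insert x J) \<and> (\<forall>i\<in>insert x J. h i \<in> S i)"
proof -
  have "card (g ` J) < card (S x)"
    using card_image_le[OF assms(1), of g] assms(5) by simp
  then have "\<not> S x \<subseteq> g ` J"
    using assms(1) by (meson card_mono finite_imageI not_less)
  then obtain c where "c \<in> S x" "c \<notin> g ` J" by blast
  then have "inj_on (g(x := c)) (insert x J)" "\<forall>i\<in>insert x J. (g(x := c)) i \<in> S i"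
    using assms by (auto simp: inj_on_def)
  then show ?thesis by blast
qed

text \<open>When an index is served, fewer than \<open>card J\<close> values are taken, so its
  candidate set still has a free one.\<close>

lemma ex_distinct_representatives:
  assumes "finite J" "\<forall>i\<in>J. card J \<le> card (S i)"
  shows "\<exists>g. inj_on g J \<and> (\<forall>i\<in>J. g i \<in> S i)"
  using assms
proof (induction J rule: finite_induct)
  case empty
  then show ?case by simp
next
  case (insert x J)
  then have "\<forall>i\<in>J. card J \<le> card (S i)" by auto
  then obtain g where "inj_on g J" "\<forall>i\<in>J. g i \<in> S i" using insert.IH by blast
  then show ?case
    using insert by (intro extend_distinct_representatives[of J x g]) auto
qed

section \<open>How many colors are necessary and how many suffice\<close>

lemma properly_distinguishable_book_graph_bound:
  assumes "properly_distinguishable (book_graph n) r"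
  shows "r \<ge> 2" "n \<le> (r - 1) * (r - 2) + 1"
proof -
  obtain f :: "nat \<times> nat \<Rightarrow> nat" where f: "f ` verts (book_graph n) \<subseteq> {..<r}"
      "proper_coloring (book_graph n) f" "distinguishing (book_graph n) f"
    using assms unfolding properly_distinguishable_def by blast
  let ?a = "f (0, 0)" and ?b = "f (0, 1)"
  have lt: "f (i, x) < r" if "i \<le> n" "x \<in> {0, 1}" for i x
    using f(1) that unfolding verts_book_graph by (force simp: image_subset_iff)
  have ab: "?a \<noteq> ?b" "?a < r" "?b < r"
    using f(2) lt by (auto simp: proper_coloring_book_graph_iff)
  then show "r \<ge> 2" by linarith
  have "(\<lambda>i. (f (i, 0), f (i, 1))) ` {1..n} \<subseteq> page_pairs ?a ?b {..<r} {..<r}"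
    using f(2) lt by (auto simp: proper_coloring_book_graph_iff page_pairs_def)
  moreover have "finite (page_pairs ?a ?b {..<r} {..<r})"
    by (rule finite_subset[of _ "{..<r} \<times> {..<r}"]) (auto simp: page_pairs_def)
  ultimately have "card {1..n} \<le> card (page_pairs ?a ?b {..<r} {..<r})"
    by (rule card_inj_on_le[OF distinguishing_book_graph_pages_inj[OF f(3)]])
  also have "\<dots> = (r - 1) * (r - 2) + 1"
    using card_page_pairs_same[of "{..<r}" ?a ?b] ab by simp
  finally show "n \<le> (r - 1) * (r - 2) + 1" by simp
qed

lemma ex_spine_colors:
  assumes "finite A" "finite B" "card A \<ge> 2" "card B \<ge> 2"
  shows "\<exists>a\<in>A. \<exists>b\<in>B. a \<noteq> b \<and> \<not> (a \<in> X \<and> X - {a} = Y - {b})"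
proof -
  have ex: "\<exists>c\<in>C. c \<noteq> d" if "finite C" "card C \<ge> 2" for C and d :: 'a
  proof (rule ccontr)
    assume "\<not> ?thesis"
    then have "C \<subseteq> {d}" by auto
    then show False using card_mono[of "{d}" C] that by simp
  qed
  obtain a where a: "a \<in> A" using assms(3) by fastforce
  obtain b where b: "b \<in> B" "b \<noteq> a" using ex assms by metis
  obtain a' where a': "a' \<in> A" "a' \<noteq> a" using ex assms by metis
  obtain b' where b': "b' \<in> B" "b' \<noteq> a'" using ex assms by metis
  \<comment> \<open>If both pairs were exceptional, \<open>a\<close> would lie in
    \<open>X - {a'} = Y - {b'}\<close>, hence in \<open>Y\<close>, but not in
    \<open>X - {a} = Y - {b}\<close>, which forces \<open>a = b\<close>.\<close>
  have "\<not> (a \<in> X \<and> X - {a} = Y - {b}) \<or> \<not> (a' \<in> X \<and> X - {a'} = Y - {b'})"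
    using b a' by blast
  then show ?thesis using a b a' b' by metis
qed

lemma properly_list_distinguishable_book_graph:
  assumes "n \<ge> 2" "k \<ge> 2" "n \<le> (k - 1) * (k - 2) + 1"
  shows "properly_list_distinguishable (book_graph n) k"
  unfolding properly_list_distinguishable_def
proof (intro allI impI)
  fix L :: "nat \<times> nat \<Rightarrow> nat set"
  assume "\<forall>v\<in>verts (book_graph n). finite (L v) \<and> card (L v) = k"
  then have L: "finite (L (i, x))" "card (L (i, x)) = k" if "i \<le> n" "x \<in> {0, 1}" for i x
    using that by (auto simp: verts_book_graph)
  obtain a b where ab: "a \<in> L (0, 0)" "b \<in> L (0, 1)" "a \<noteq> b"
      "\<not> (a \<in> L (1, 0) \<and> L (1, 0) - {a} = L (1, 1) - {b})"
    using ex_spine_colors[of "L (0, 0)" "L (0, 1)" "L (1, 0)" "L (1, 1)"] L assms(2) by auto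
  define S where "S i = page_pairs a b (L (i, 0)) (L (i, 1))" for i
  \<comment> \<open>The weaker count suffices here, since only \<open>n - 1\<close> pages are served
    before page 1.\<close>
  have "n - 1 \<le> card (S i)" if "i \<in> {2..n}" for i
    using card_page_pairs_ge(1)[of "L (i, 0)" "L (i, 1)" k a b] L that assms unfolding S_def
    by force
  then obtain g where "inj_on g {2..n}" "\<forall>i\<in>{2..n}. g i \<in> S i"
    using ex_distinct_representatives[of "{2..n}" S] assms(1) by auto
  \<comment> \<open>Page 1 has to avoid \<open>n - 1\<close> used pairs; the extra admissible pair
    gained from the choice of \<open>a\<close> and \<open>b\<close> makes the inequality
    strict.\<close>
  moreover have "card {2..n} < card (S 1)"
    using card_page_pairs_ge(2)[of "L (1, 0)" "L (1, 1)" k a b] L ab(4) assms unfolding S_def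
    by force
  moreover have "insert 1 {2..n} = {1..n}" using assms(1) by auto
  ultimately obtain h where h: "inj_on h {1..n}" "\<forall>i\<in>{1..n}. h i \<in> S i"
    using extend_distinct_representatives[of "{2..n}" 1 g S] by auto
  define f where "f = (\<lambda>(i, x). if i = 0 then (if x = 0 then a else b)
      else if x = (0 :: nat) then fst (h i) else snd (h i))"
  have hi: "fst (h i) \<in> L (i, 0)" "snd (h i) \<in> L (i, 1)" "fst (h i) \<noteq> a" "snd (h i) \<noteq> b"
      "fst (h i) \<noteq> snd (h i)" if "i \<in> {1..n}" for i
    using bspec[OF h(2) that] by (auto simp: S_def page_pairs_def split: prod.splits)
  have "\<forall>v\<in>verts (book_graph n). f v \<in> L v"
    using hi ab by (auto simp: verts_book_graph f_def)
  moreover have "proper_coloring (book_graph n) f"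
    unfolding proper_coloring_book_graph_iff using hi ab by (auto simp: f_def)
  moreover have "inj_on (\<lambda>i. (f (i, 0), f (i, 1))) {1..n}"
    using h(1) by (subst inj_on_cong[where g = h]) (auto simp: f_def)
  ultimately show "properly_L_distinguishable (book_graph n) L"
    using distinguishing_book_graphI[OF assms(1)] unfolding properly_L_distinguishable_def by blast
qed

text \<open>Ordinary colorings are the case of the constant list \<open>{..<k}\<close>.\<close>

lemma properly_list_distinguishable_imp_properly_distinguishable:
  assumes "properly_list_distinguishable G k"
  shows "properly_distinguishable G k"
proof -
  have "properly_L_distinguishable G (\<lambda>_. {..<k})"
    using assms by (simp add: properly_list_distinguishable_def)
  then show ?thesis
    unfolding properly_L_distinguishable_def properly_distinguishable_def by blast
qed

theorem theorem5p11:
  fixes n :: nat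
  assumes "n \<ge> 2"
  shows "list_distinguishing_chromatic_number (book_graph n)
       = distinguishing_chromatic_number (book_graph n)"
proof -
  \<comment> \<open>Both properties amount to \<open>k \<ge> 2\<close> and
    \<open>n \<le> (k - 1) * (k - 2) + 1\<close>, so the two minima are taken over the same
    set.\<close>
  have "properly_list_distinguishable (book_graph n) k \<longleftrightarrow>
      properly_distinguishable (book_graph n) k" for k
    using properly_list_distinguishable_imp_properly_distinguishable
      properly_distinguishable_book_graph_bound
      properly_list_distinguishable_book_graph[OF assms] by blast
  then show ?thesis
    unfolding list_distinguishing_chromatic_number_def distinguishing_chromatic_number_def by presburger
qed

end
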